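(* For any $\beta_{\mathrm{pl}},\beta_{\mathrm{op}}\in\mathbb{R}$, two-player stochastic games with soft Q-learning have a unique value: for every state $\bm s\in\mathcal S$, $$\mathcal{V}^\star_{\mathrm{pl}}(\bm s)=\mathcal{V}^\star_{\mathrm{op}}(\bm s),$$ where $$\mathcal{V}^\star_{\mathrm{pl}}(\bm s)=\max_{\pi_{\mathrm{pl}}}\,\mathrm{ext}_{\pi_{\mathrm{op}}}\,\mathcal{V}^{\pi_{\mathrm{pl}}\pi_{\mathrm{op}}}(\bm s),\qquad \mathcal{V}^\star_{\mathrm{op}}(\bm s)=\mathrm{ext}_{\pi_{\mathrm{op}}}\max_{\pi_{\mathrm{pl}}}\,\mathcal{V}^{\pi_{\mathrm{pl}}\pi_{\mathrm{op}}}(\bm s).$$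
   Context: Two-player stochastic game: $\mathcal{S}$ is a finite nonempty state space, $\mathcal{A}$ a finite nonempty action set used by both the player (pl) and the opponent (op), $\mathcal{R}_{\mathcal{G}}:\mathcal{S}\times\mathcal{A}\times\mathcal{A}\to\mathbb{R}$ the reward function, $\mathcal{T}_{\mathcal{G}}(\cdot\,|\,\bm s,\bm a^{\mathrm{pl}},\bm a^{\mathrm{op}})$ a probability distribution on $\mathcal{S}$ for each $(\bm s,\bm a^{\mathrm{pl}},\bm a^{\mathrm{op}})$, and $\gamma\in[0,1)$ the discount factor. A policy $\pi$ assigns to each $\bm s\in\mathcal{S}$ a probability distribution $\pi(\cdot|\bm s)$ on $\mathcal{A}$; $\pi_{\mathrm{pl}}$ and $\pi_{\mathrm{op}}$ denote policies of the player and the opponent. The reference policies $\rho_{\mathrm{pl}},\rho_{\mathrm{op}}$ are uniform on $\mathcal{A}$ in every state. The policy-dependent soft value is $$\mathcal{V}^{\pi_{\mathrm{pl}}\pi_{\mathrm{op}}}(\bm s)=\mathbb{E}\Big[\sum_{t=0}^{\infty}\gamma^t\Big(\mathcal{R}_{\mathcal{G}}(\bm s_t,\bm a^{\mathrm{pl}}_t,\bm a^{\mathrm{op}}_t)-\tfrac{1}{\beta_{\mathrm{pl}}}\log\tfrac{\pi_{\mathrm{pl}}(\bm a^{\mathrm{pl}}_t|\bm s_t)}{\rho_{\mathrm{pl}}(\bm a^{\mathrm{pl}}_t|\bm s_t)}-\tfrac{1}{\beta_{\mathrm{op}}}\log\tfrac{\pi_{\mathrm{op}}(\bm a^{\mathrm{op}}_t|\bm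 s_t)}{\rho_{\mathrm{op}}(\bm a^{\mathrm{op}}_t|\bm s_t)}\Big)\Big],$$ where the expectation is over trajectories with $\bm s_0=\bm s$, independent $\bm a^{\mathrm{pl}}_t\sim\pi_{\mathrm{pl}}(\cdot|\bm s_t)$ and $\bm a^{\mathrm{op}}_t\sim\pi_{\mathrm{op}}(\cdot|\bm s_t)$, and $\bm s_{t+1}\sim\mathcal{T}_{\mathcal{G}}(\cdot|\bm s_t,\bm a^{\mathrm{pl}}_t,\bm a^{\mathrm{op}}_t)$ (convention $0\log 0=0$). The value $\beta=0$ for an agent is read as the limiting case in which that agent simply uses its reference policy $\rho$ (its policy is fixed to $\rho$ and its logarithmic term is $0$). The symbol $\mathrm{ext}_{\pi_{\mathrm{op}}}$ means $\max_{\pi_{\mathrm{op}}}$ if $\beta_{\mathrm{op}}>0$ and $\min_{\pi_{\mathrm{op}}}$ if $\beta_{\mathrm{op}}<0$; for the player the operation is always $\max_{\pi_{\mathrm{pl}}}$. The extrema range over all policies of the respective agent.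
   Formalization: Proved only when β_pl ≥ 0 or β_op ≥ 0. With both negative and the player always maximizing, the claim fails: for every such pair, one-state matching pennies with γ = 0 and stakes 1/|β_op| gives V*_pl < V*_op. *)

theory Defs
  imports "HOL-Probability.Probability"
begin

type_synonym ('s, 'a) policy = "'s \<Rightarrow> 'a pmf"

definition uniform_policy :: "('s, 'a::finite) policy" where
  "uniform_policy = (\<lambda>_. pmf_of_set UNIV)"

(* An agent with parameter 0 can only use the reference policy. *)
definition policies :: "real \<Rightarrow> ('s, 'a::finite) policy set" where
  "policies \<beta> = (if \<beta> = 0 then {uniform_policy} else UNIV)"

(* Where the policy has probability 0 this is ln 0 / \<beta> = 0; such actions have probability 0, so
   this is the convention 0 log 0 = 0 and no infinite value arises. *)
definition info_cost :: "real \<Rightarrow> ('s, 'a::finite) policy \<Rightarrow> 's \<Rightarrow> 'a \<Rightarrow> real" where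
  "info_cost \<beta> \<pi> s a =
     (if \<beta> = 0 then 0 else 1 / \<beta> * ln (pmf (\<pi> s) a / pmf (uniform_policy s) a))"

definition soft_reward ::
  "('s \<Rightarrow> 'a \<Rightarrow> 'a \<Rightarrow> real) \<Rightarrow> real \<Rightarrow> real \<Rightarrow> ('s, 'a::finite) policy \<Rightarrow> ('s, 'a) policy
     \<Rightarrow> 's \<times> 'a \<times> 'a \<Rightarrow> real" where
  "soft_reward R \<beta>pl \<beta>op \<pi>pl \<pi>op =
     (\<lambda>(s, a, b). R s a b - info_cost \<beta>pl \<pi>pl s a - info_cost \<beta>op \<pi>op s b)"

(* A trajectory is a function \<omega> with \<omega> t = (s_t, a_t^pl, a_t^op). *)

definition act :: "('s, 'a) policy \<Rightarrow> ('s, 'a) policy \<Rightarrow> 's \<Rightarrow> ('s \<times> 'a \<times> 'a) pmf" where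
  "act \<pi>pl \<pi>op s = map_pmf (Pair s) (pair_pmf (\<pi>pl s) (\<pi>op s))"

definition step_kernel ::
  "('s \<Rightarrow> 'a \<Rightarrow> 'a \<Rightarrow> 's pmf) \<Rightarrow> ('s, 'a) policy \<Rightarrow> ('s, 'a) policy \<Rightarrow> 's
     \<Rightarrow> nat \<Rightarrow> (nat \<Rightarrow> 's \<times> 'a \<times> 'a) \<Rightarrow> ('s \<times> 'a \<times> 'a) measure" where
  "step_kernel T \<pi>pl \<pi>op s0 n \<omega> = measure_pmf
     (case n of
        0 \<Rightarrow> act \<pi>pl \<pi>op s0
      | Suc t \<Rightarrow> (case \<omega> t of (s, a, b) \<Rightarrow> bind_pmf (T s a b) (act \<pi>pl \<pi>op)))"

(* The unique measure on infinite trajectories with the transition kernels above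
   (Ionescu-Tulcea); the lemma below shows that the construction applies. *)
definition trajectories ::
  "('s \<Rightarrow> 'a \<Rightarrow> 'a \<Rightarrow> 's pmf) \<Rightarrow> ('s, 'a) policy \<Rightarrow> ('s, 'a) policy \<Rightarrow> 's
     \<Rightarrow> (nat \<Rightarrow> 's \<times> 'a \<times> 'a) measure" where
  "trajectories T \<pi>pl \<pi>op s0 =
     projective_family.lim UNIV
       (Ionescu_Tulcea.CI (step_kernel T \<pi>pl \<pi>op s0) (\<lambda>_. count_space UNIV)) (\<lambda>_. count_space UNIV)"

lemma Ionescu_Tulcea_step_kernel:
  fixes T :: "'s::finite \<Rightarrow> 'a::finite \<Rightarrow> 'a \<Rightarrow> 's pmf"
  shows "Ionescu_Tulcea (step_kernel T \<pi>pl \<pi>op s0) (\<lambda>_. count_space UNIV)"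
proof (rule Ionescu_Tulcea.intro)
  fix n :: nat
  show "step_kernel T \<pi>pl \<pi>op s0 n \<in>
      measurable (PiM {0..<n} (\<lambda>_. count_space UNIV)) (subprob_algebra (count_space UNIV))"
  proof (cases n)
    case 0
    have "measure_pmf (act \<pi>pl \<pi>op s0) \<in> space (subprob_algebra (count_space UNIV))"
      by (simp add: space_subprob_algebra measure_pmf.subprob_space_axioms)
    moreover have "step_kernel T \<pi>pl \<pi>op s0 n = (\<lambda>_. measure_pmf (act \<pi>pl \<pi>op s0))"
      by (simp add: 0 step_kernel_def fun_eq_iff)
    ultimately show ?thesis
      by simp
  next
    case (Suc t)
    have "(\<lambda>\<omega>. \<omega> t) \<in> measurable (PiM {0..<n} (\<lambda>_. count_space UNIV))
        (count_space (UNIV :: ('s \<times> 'a \<times> 'a) set))"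
      using Suc by (intro measurable_component_singleton) auto
    moreover have "(\<lambda>x. measure_pmf (case x of (s, a, b) \<Rightarrow> bind_pmf (T s a b) (act \<pi>pl \<pi>op)))
        \<in> measurable (count_space UNIV) (subprob_algebra (count_space UNIV))"
      by (simp add: space_subprob_algebra measure_pmf.subprob_space_axioms)
    moreover have "step_kernel T \<pi>pl \<pi>op s0 n =
        (\<lambda>\<omega>. measure_pmf (case \<omega> t of (s, a, b) \<Rightarrow> bind_pmf (T s a b) (act \<pi>pl \<pi>op)))"
      by (simp add: Suc step_kernel_def fun_eq_iff)
    ultimately show ?thesis
      by (simp add: measurable_compose)
  qed
qed (simp add: step_kernel_def measure_pmf.prob_space_axioms)

definition soft_value ::
  "('s \<Rightarrow> 'a \<Rightarrow> 'a \<Rightarrow> real) \<Rightarrow> ('s \<Rightarrow> 'a \<Rightarrow> 'a \<Rightarrow> 's pmf) \<Rightarrow> real \<Rightarrow> real \<Rightarrow> real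
     \<Rightarrow> ('s, 'a::finite) policy \<Rightarrow> ('s, 'a) policy \<Rightarrow> 's \<Rightarrow> real" where
  "soft_value R T \<gamma> \<beta>pl \<beta>op \<pi>pl \<pi>op s =
     (\<integral>\<omega>. (\<Sum>t. \<gamma> ^ t * soft_reward R \<beta>pl \<beta>op \<pi>pl \<pi>op (\<omega> t)) \<partial>trajectories T \<pi>pl \<pi>op s)"

definition maximum :: "'p set \<Rightarrow> ('p \<Rightarrow> real) \<Rightarrow> real" where
  "maximum X f = (GREATEST v. v \<in> f ` X)"

definition minimum :: "'p set \<Rightarrow> ('p \<Rightarrow> real) \<Rightarrow> real" where
  "minimum X f = (LEAST v. v \<in> f ` X)"

definition has_maximum :: "'p set \<Rightarrow> ('p \<Rightarrow> real) \<Rightarrow> bool" where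
  "has_maximum X f \<longleftrightarrow> (\<exists>x\<in>X. \<forall>y\<in>X. f y \<le> f x)"

definition has_minimum :: "'p set \<Rightarrow> ('p \<Rightarrow> real) \<Rightarrow> bool" where
  "has_minimum X f \<longleftrightarrow> (\<exists>x\<in>X. \<forall>y\<in>X. f x \<le> f y)"

(* For \<beta> = 0 the opponent has a single admissible policy, so the choice of branch is immaterial. *)
definition ext :: "real \<Rightarrow> 'p set \<Rightarrow> ('p \<Rightarrow> real) \<Rightarrow> real" where
  "ext \<beta> X f = (if \<beta> < 0 then minimum X f else maximum X f)"

definition has_ext :: "real \<Rightarrow> 'p set \<Rightarrow> ('p \<Rightarrow> real) \<Rightarrow> bool" where
  "has_ext \<beta> X f \<longleftrightarrow> (if \<beta> < 0 then has_minimum X f else has_maximum X f)"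

definition value_pl ::
  "('s \<Rightarrow> 'a \<Rightarrow> 'a \<Rightarrow> real) \<Rightarrow> ('s \<Rightarrow> 'a::finite \<Rightarrow> 'a \<Rightarrow> 's pmf) \<Rightarrow> real \<Rightarrow> real \<Rightarrow> real \<Rightarrow> 's \<Rightarrow> real"
  where
  "value_pl R T \<gamma> \<beta>pl \<beta>op s =
     maximum (policies \<beta>pl) (\<lambda>\<pi>pl. ext \<beta>op (policies \<beta>op) (\<lambda>\<pi>op.
       soft_value R T \<gamma> \<beta>pl \<beta>op \<pi>pl \<pi>op s))"

definition value_op ::
  "('s \<Rightarrow> 'a \<Rightarrow> 'a \<Rightarrow> real) \<Rightarrow> ('s \<Rightarrow> 'a::finite \<Rightarrow> 'a \<Rightarrow> 's pmf) \<Rightarrow> real \<Rightarrow> real \<Rightarrow> real \<Rightarrow> 's \<Rightarrow> real"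
  where
  "value_op R T \<gamma> \<beta>pl \<beta>op s =
     ext \<beta>op (policies \<beta>op) (\<lambda>\<pi>op. maximum (policies \<beta>pl) (\<lambda>\<pi>pl.
       soft_value R T \<gamma> \<beta>pl \<beta>op \<pi>pl \<pi>op s))"

(* Maximum and minimum need not commute when both parameters are negative: the objective is then
   convex in the policy of the maximising player as well. Matching pennies with \<gamma> = 0 gives, for
   every such pair of parameters and suitable stakes, value_pl < value_op. *)

(* All four extrema in value_pl and value_op are attained, so that these are genuine maxima and
   minima and not unspecified values of GREATEST and LEAST. *)
definition extrema_attained ::
  "('s \<Rightarrow> 'a \<Rightarrow> 'a \<Rightarrow> real) \<Rightarrow> ('s \<Rightarrow> 'a::finite \<Rightarrow> 'a \<Rightarrow> 's pmf) \<Rightarrow> real \<Rightarrow> real \<Rightarrow> real \<Rightarrow> 's \<Rightarrow> bool"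
  where
  "extrema_attained R T \<gamma> \<beta>pl \<beta>op s \<longleftrightarrow>
     (\<forall>\<pi>pl\<in>policies \<beta>pl. has_ext \<beta>op (policies \<beta>op) (\<lambda>\<pi>op.
        soft_value R T \<gamma> \<beta>pl \<beta>op \<pi>pl \<pi>op s)) \<and>
     has_maximum (policies \<beta>pl) (\<lambda>\<pi>pl. ext \<beta>op (policies \<beta>op) (\<lambda>\<pi>op.
        soft_value R T \<gamma> \<beta>pl \<beta>op \<pi>pl \<pi>op s)) \<and>
     (\<forall>\<pi>op\<in>policies \<beta>op. has_maximum (policies \<beta>pl) (\<lambda>\<pi>pl.
        soft_value R T \<gamma> \<beta>pl \<beta>op \<pi>pl \<pi>op s)) \<and>
     has_ext \<beta>op (policies \<beta>op) (\<lambda>\<pi>op. maximum (policies \<beta>pl) (\<lambda>\<pi>pl.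
        soft_value R T \<gamma> \<beta>pl \<beta>op \<pi>pl \<pi>op s))"

end

theory Submission
  imports Defs "HOL-Real_Asymp.Real_Asymp"
begin

text \<open>
  The value of a pair of policies is the only fixed point of its Bellman operator, which is monotone
  and a contraction; so a function below (above) its image lies below (above) the value. If the two
  agents both maximise, let \<open>W\<close> be the pointwise supremum of the values of all policy pairs. A pair that
  is greedy for \<open>W\<close> has a value of at least \<open>W\<close> and is therefore optimal in every state at once. The
  same argument with one policy held fixed, applied to the negated game for minima, shows that the
  inner extrema are attained. If the opponent minimises, it is enough to find a saddle point. In a
  one-shot game with entropy costs the best responses are softmax distributions, so Brouwer's theorem,
  applied to triples (player policy, opponent policy, value function), gives two policies that are
  softmax responses to each other with respect to their own value.
\<close>

section \<open>The Bellman equation\<close>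

text \<open>The law of the triple at time \<open>t\<close>, built without the space of infinite
  trajectories; \<open>distr_trajectories\<close> identifies it as a marginal.\<close>

primrec law ::
  "('s \<Rightarrow> 'a \<Rightarrow> 'a \<Rightarrow> 's pmf) \<Rightarrow> ('s, 'a) policy \<Rightarrow> ('s, 'a) policy \<Rightarrow> 's \<Rightarrow> nat
     \<Rightarrow> ('s \<times> 'a \<times> 'a) pmf" where
  "law T \<pi> \<tau> s 0 = act \<pi> \<tau> s"
| "law T \<pi> \<tau> s (Suc t) = bind_pmf (law T \<pi> \<tau> s t) (\<lambda>(s, a, b). bind_pmf (T s a b) (act \<pi> \<tau>))"

text \<open>\<open>law\<close> appends steps at the end, while the Bellman equation conditions on
  the first step; associativity of \<open>bind_pmf\<close> moves the recursion to the other
  end.\<close>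

lemma law_Suc_first:
  "law T \<pi> \<tau> s (Suc t) =
     bind_pmf (act \<pi> \<tau> s) (\<lambda>(s, a, b). bind_pmf (T s a b) (\<lambda>s'. law T \<pi> \<tau> s' t))"
proof (induction t)
  case (Suc t)
  have "law T \<pi> \<tau> s (Suc (Suc t)) =
      bind_pmf (law T \<pi> \<tau> s (Suc t)) (\<lambda>(s, a, b). bind_pmf (T s a b) (act \<pi> \<tau>))"
    by simp
  also have "\<dots> = bind_pmf (act \<pi> \<tau> s)
      (\<lambda>(s, a, b). bind_pmf (T s a b) (\<lambda>s'. law T \<pi> \<tau> s' (Suc t)))"
    unfolding Suc.IH by (simp add: bind_assoc_pmf case_prod_unfold)
  finally show ?case .
qed (simp add: case_prod_unfold)

section \<open>Marginals of the trajectory measure\<close>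

context Ionescu_Tulcea
begin

text \<open>The integrand depends only on the restriction of \<open>\<omega>\<close> to
  \<open>{n}\<close>, whose distribution under the projective limit is given by
  \<open>distr_lim\<close>.\<close>

lemma nn_integral_lim_coordinate:
  assumes f[measurable]: "f \<in> borel_measurable (M n)"
  shows "(\<integral>\<^sup>+\<omega>. f (\<omega> n) \<partial>PF.lim) = (\<integral>\<^sup>+\<omega>. f (\<omega> n) \<partial>C 0 (Suc n) (\<lambda>_. undefined))"
proof -
  \<comment> \<open>\<open>C 0 m\<close> fixes the coordinates below \<open>m\<close>, so coordinate
    \<open>n\<close> appears only after \<open>Suc n\<close> steps.\<close>
  have up: "up_to {n} = Suc n"
    by (intro antisym) (auto simp: up_to_iff Suc_le_eq up_to_less)
  have mF: "(\<lambda>\<omega>. f (\<omega> n)) \<in> borel_measurable (PiM {n} M)"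
    by measurable
  have sC: "sets (C 0 (Suc n) (\<lambda>_. undefined)) = sets (PiM {0..<Suc n} M)"
    by (subst sets_C) auto
  have "(\<integral>\<^sup>+\<omega>. f (\<omega> n) \<partial>PF.lim) = (\<integral>\<^sup>+\<omega>. f (restrict \<omega> {n} n) \<partial>PF.lim)"
    by simp
  also have "\<dots> = (\<integral>\<^sup>+\<omega>. f (\<omega> n) \<partial>distr PF.lim (PiM {n} M) (\<lambda>x. restrict x {n}))"
    by (subst nn_integral_distr)
      (auto simp: measurable_cong_sets[OF PF.sets_lim] intro!: measurable_restrict)
  also have "\<dots> = (\<integral>\<^sup>+\<omega>. f (\<omega> n) \<partial>distr (C 0 (Suc n) (\<lambda>_. undefined)) (PiM {n} M) (\<lambda>x. restrict x {n}))"
    by (subst distr_lim) (simp_all add: CI_def up del: C.simps)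
  also have "\<dots> = (\<integral>\<^sup>+\<omega>. f (restrict \<omega> {n} n) \<partial>C 0 (Suc n) (\<lambda>_. undefined))"
    by (subst nn_integral_distr)
      (auto simp: measurable_cong_sets[OF sC] simp del: C.simps intro!: measurable_restrict)
  finally show ?thesis
    by simp
qed

lemma nn_integral_C_Suc_coordinate:
  assumes f[measurable]: "f \<in> borel_measurable (M n)"
  shows "(\<integral>\<^sup>+\<omega>. f (\<omega> n) \<partial>C 0 (Suc n) (\<lambda>_. undefined)) =
    (\<integral>\<^sup>+\<omega>. (\<integral>\<^sup>+x. f x \<partial>P n \<omega>) \<partial>C 0 n (\<lambda>_. undefined))"
proof -
  have mF: "(\<lambda>\<omega>. f (\<omega> n)) \<in> borel_measurable (PiM {0..<Suc n} M)"
    by measurable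
  have u: "(\<lambda>_. undefined) \<in> space (PiM {0..<0} M)"
    by simp
  have sp: "space (C 0 n (\<lambda>_. undefined)) = space (PiM {0..<n} M)"
    using space_C[OF u, of n] by simp
  have sC: "sets (C 0 n (\<lambda>_. undefined)) = sets (PiM {0..<n} M)"
    using sets_C[OF u, of n] by simp
  have "(\<integral>\<^sup>+\<omega>. f (\<omega> n) \<partial>C 0 (Suc n) (\<lambda>_. undefined)) =
      (\<integral>\<^sup>+\<omega>. (\<integral>\<^sup>+\<omega>'. f (\<omega>' n) \<partial>eP n \<omega>) \<partial>C 0 n (\<lambda>_. undefined))"
    by (simp, subst nn_integral_bind[OF mF])
      (use measurable_eP[of n] in \<open>simp_all add: measurable_cong_sets[OF sC]\<close>)
  also have "\<dots> = (\<integral>\<^sup>+\<omega>. (\<integral>\<^sup>+x. f x \<partial>P n \<omega>) \<partial>C 0 n (\<lambda>_. undefined))"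
    by (intro nn_integral_cong) (simp add: sp nn_integral_eP[OF _ mF])
  finally show ?thesis .
qed

end

text \<open>One-time marginals suffice, because the expectation of the discounted sum is computed
  term by term.\<close>

lemma
  fixes T :: "'s::finite \<Rightarrow> 'a::finite \<Rightarrow> 'a \<Rightarrow> 's pmf"
  shows prob_space_trajectories: "prob_space (trajectories T \<pi> \<tau> s)"
    and sets_trajectories:
      "sets (trajectories T \<pi> \<tau> s) = sets (PiM UNIV (\<lambda>_. count_space UNIV))"
    and distr_trajectories:
      "distr (trajectories T \<pi> \<tau> s) (count_space UNIV) (\<lambda>\<omega>. \<omega> t) = measure_pmf (law T \<pi> \<tau> s t)"
proof -
  interpret IT: Ionescu_Tulcea "step_kernel T \<pi> \<tau> s" "\<lambda>_. count_space UNIV"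
    by (rule Ionescu_Tulcea_step_kernel)
  let ?C = "\<lambda>n. IT.C 0 n (\<lambda>_. undefined)"
  show sets: "sets (trajectories T \<pi> \<tau> s) = sets (PiM UNIV (\<lambda>_. count_space UNIV))"
    unfolding trajectories_def by simp
  have marginal: "(\<integral>\<^sup>+\<omega>. f (\<omega> n) \<partial>?C (Suc n)) = (\<integral>\<^sup>+x. f x \<partial>law T \<pi> \<tau> s n)"
    for n and f :: "'s \<times> 'a \<times> 'a \<Rightarrow> ennreal"
  \<comment> \<open>\<open>f\<close> varies because the hypothesis is applied to the map that sends
    a triple to the expectation of \<open>f\<close> one step later.\<close>
  proof (induction n arbitrary: f)
    case 0
    have "prob_space (?C 0)"
      by (rule IT.prob_space_C) simp
    then show ?case
      by (subst IT.nn_integral_C_Suc_coordinate)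
        (simp_all add: step_kernel_def prob_space.emeasure_space_1 del: IT.C.simps)
  next
    case (Suc n)
    have "(\<integral>\<^sup>+\<omega>. f (\<omega> (Suc n)) \<partial>?C (Suc (Suc n))) =
        (\<integral>\<^sup>+\<omega>. (\<lambda>(s, a, b). \<integral>\<^sup>+x. f x \<partial>bind_pmf (T s a b) (act \<pi> \<tau>)) (\<omega> n) \<partial>?C (Suc n))"
      by (subst IT.nn_integral_C_Suc_coordinate)
        (simp_all add: step_kernel_def case_prod_beta del: IT.C.simps)
    then show ?case
      by (simp only: Suc.IH) (simp add: case_prod_beta)
  qed
  have lim: "(\<integral>\<^sup>+\<omega>. f (\<omega> n) \<partial>trajectories T \<pi> \<tau> s) = (\<integral>\<^sup>+x. f x \<partial>law T \<pi> \<tau> s n)"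
    for n and f :: "'s \<times> 'a \<times> 'a \<Rightarrow> ennreal"
    unfolding trajectories_def using IT.nn_integral_lim_coordinate[of f] marginal[of n f] by (simp del: IT.C.simps)
  have coord: "(\<lambda>\<omega>. \<omega> t) \<in> measurable (trajectories T \<pi> \<tau> s) (count_space UNIV)" for t
    unfolding measurable_cong_sets[OF sets refl]
    by (rule measurable_component_singleton) simp
  show "distr (trajectories T \<pi> \<tau> s) (count_space UNIV) (\<lambda>\<omega>. \<omega> t) = measure_pmf (law T \<pi> \<tau> s t)" for t
  proof (rule measure_eqI)
    fix A :: "('s \<times> 'a \<times> 'a) set"
    show "emeasure (distr (trajectories T \<pi> \<tau> s) (count_space UNIV) (\<lambda>\<omega>. \<omega> t)) A =
        emeasure (measure_pmf (law T \<pi> \<tau> s t)) A"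
      using lim[of "indicator A" t] coord
      by (subst nn_integral_indicator[symmetric], simp)
        (subst nn_integral_distr, simp_all)
  qed simp
  show "prob_space (trajectories T \<pi> \<tau> s)"
    using lim[of "\<lambda>_. 1" 0] by (intro prob_spaceI) simp
qed

text \<open>There are finitely many triples, so the soft reward is bounded; a geometric series
  dominates, and expectation and infinite sum may be exchanged.\<close>

lemma soft_value_eq_suminf:
  fixes R :: "'s::finite \<Rightarrow> 'a::finite \<Rightarrow> 'a \<Rightarrow> real"
    and \<pi> \<tau> :: "('s, 'a) policy" and T :: "'s \<Rightarrow> 'a \<Rightarrow> 'a \<Rightarrow> 's pmf" and \<beta>pl \<beta>op \<gamma> :: real
  assumes \<gamma>: "0 \<le> \<gamma>" "\<gamma> < 1"
  defines "e \<equiv> \<lambda>s t. \<integral>x. soft_reward R \<beta>pl \<beta>op \<pi> \<tau> x \<partial>law T \<pi> \<tau> s t"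
  shows "summable (\<lambda>t. \<gamma> ^ t * e s t)"
    and "soft_value R T \<gamma> \<beta>pl \<beta>op \<pi> \<tau> s = (\<Sum>t. \<gamma> ^ t * e s t)"
proof -
  let ?r = "soft_reward R \<beta>pl \<beta>op \<pi> \<tau>" and ?M = "trajectories T \<pi> \<tau> s"
  interpret prob_space ?M
    by (rule prob_space_trajectories)
  have coord: "(\<lambda>\<omega>. \<omega> t) \<in> measurable ?M (count_space UNIV)" for t
    unfolding measurable_cong_sets[OF sets_trajectories refl]
    by (rule measurable_component_singleton) simp
  have meas: "(\<lambda>\<omega>. ?r (\<omega> t)) \<in> borel_measurable ?M" for t
    by (rule measurable_compose[OF coord]) simp
  define B where "B = Max (range (\<lambda>x. \<bar>?r x\<bar>))"
  have B: "\<bar>?r x\<bar> \<le> B" for x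
    unfolding B_def by (rule Max_ge) auto
  have bound: "norm (\<gamma> ^ t * ?r x) \<le> B * \<gamma> ^ t" for t x
    using B[of x] \<gamma> by (simp add: abs_mult mult.commute[of B] mult_left_mono)
  have geo: "summable (\<lambda>t. B * \<gamma> ^ t)"
    using \<gamma> by (intro summable_mult summable_geometric) simp
  have int: "integrable ?M (\<lambda>\<omega>. \<gamma> ^ t * ?r (\<omega> t))" for t
    using bound by (intro integrable_const_bound[where B = "B * \<gamma> ^ t"]) (auto intro!: borel_measurable_times meas)
  have norm_le: "(\<integral>\<omega>. norm (\<gamma> ^ t * ?r (\<omega> t)) \<partial>?M) \<le> B * \<gamma> ^ t" for t
    using bound[of t] by (intro integral_le_const integrable_norm int) auto
  have sum_norm: "summable (\<lambda>t. \<integral>\<omega>. norm (\<gamma> ^ t * ?r (\<omega> t)) \<partial>?M)"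
    by (rule summable_comparison_test'[OF geo, of 0])
      (use norm_le in \<open>simp add: integral_nonneg_AE\<close>)
  have sum_ae: "AE \<omega> in ?M. summable (\<lambda>t. norm (\<gamma> ^ t * ?r (\<omega> t)))"
    using bound by (intro AE_I2 summable_comparison_test'[OF geo, of 0]) (auto simp: abs_mult)
  have e: "(\<integral>\<omega>. \<gamma> ^ t * ?r (\<omega> t) \<partial>?M) = \<gamma> ^ t * e s t" for t
    unfolding e_def distr_trajectories[symmetric]
    by (subst integral_distr[OF coord]) simp_all
  show "summable (\<lambda>t. \<gamma> ^ t * e s t)"
    using summable_integral[OF int sum_ae sum_norm] unfolding e .
  show "soft_value R T \<gamma> \<beta>pl \<beta>op \<pi> \<tau> s = (\<Sum>t. \<gamma> ^ t * e s t)"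
    using integral_suminf[OF int sum_ae sum_norm] unfolding e soft_value_def .
qed

section \<open>The one-step payoff and the Bellman equation\<close>

lemma integral_pmf_finite:
  fixes f :: "'b::finite \<Rightarrow> real"
  shows "(\<integral>x. f x \<partial>measure_pmf p) = (\<Sum>x\<in>UNIV. pmf p x * f x)"
  by (subst integral_measure_pmf_real[of UNIV]) (simp_all add: mult.commute)

lemma integral_act:
  fixes f :: "'s \<times> 'a::finite \<times> 'a \<Rightarrow> real"
  shows "(\<integral>x. f x \<partial>act \<pi> \<tau> s) = (\<Sum>a\<in>UNIV. \<Sum>b\<in>UNIV. pmf (\<pi> s) a * pmf (\<tau> s) b * f (s, a, b))"
  by (auto simp: act_def integral_pmf_finite pmf_pair sum.cartesian_product
      simp flip: UNIV_Times_UNIV intro!: sum.cong)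

lemma integral_bind_pmf_finite:
  fixes f :: "'b::finite \<Rightarrow> real" and M :: "'c::finite pmf"
  shows "(\<integral>x. f x \<partial>bind_pmf M N) = (\<integral>y. (\<integral>x. f x \<partial>N y) \<partial>M)"
  by (subst pmf_expectation_bind[of UNIV]) (simp_all add: integral_pmf_finite)

text \<open>For \<open>\<beta> = 0\<close> the division yields 0, which is the cost wanted in that case.\<close>

definition mean_cost :: "real \<Rightarrow> 'a::finite pmf \<Rightarrow> real" where
  "mean_cost \<beta> p = (\<Sum>a\<in>UNIV. pmf p a * ln (pmf p a * CARD('a))) / \<beta>"

text \<open>The Q-function with continuation value \<open>v\<close>. Costs are left out, since they
  depend on the mixed actions.\<close>

definition gain ::
  "('s \<Rightarrow> 'a \<Rightarrow> 'a \<Rightarrow> real) \<Rightarrow> ('s::finite \<Rightarrow> 'a \<Rightarrow> 'a \<Rightarrow> 's pmf) \<Rightarrow> real \<Rightarrow> ('s \<Rightarrow> real)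
     \<Rightarrow> 's \<Rightarrow> 'a \<Rightarrow> 'a \<Rightarrow> real" where
  "gain R T \<gamma> v s a b = R s a b + \<gamma> * (\<Sum>s'\<in>UNIV. pmf (T s a b) s' * v s')"

text \<open>The right-hand side of the Bellman equation with the two mixed actions as free
  arguments: for fixed \<open>v\<close>, a one-shot game in each state.\<close>

definition payoff ::
  "('s \<Rightarrow> 'a \<Rightarrow> 'a \<Rightarrow> real) \<Rightarrow> ('s::finite \<Rightarrow> 'a::finite \<Rightarrow> 'a \<Rightarrow> 's pmf) \<Rightarrow> real \<Rightarrow> real \<Rightarrow> real
     \<Rightarrow> ('s \<Rightarrow> real) \<Rightarrow> 's \<Rightarrow> 'a pmf \<Rightarrow> 'a pmf \<Rightarrow> real" where
  "payoff R T \<gamma> \<beta>pl \<beta>op v s p q =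
     (\<Sum>a\<in>UNIV. \<Sum>b\<in>UNIV. pmf p a * pmf q b * gain R T \<gamma> v s a b)
     - mean_cost \<beta>pl p - mean_cost \<beta>op q"

lemma sum_pmf_UNIV [simp]: "(\<Sum>a\<in>UNIV. pmf (p :: 'a::finite pmf) a) = 1"
  by (rule sum_pmf_eq_1) simp_all

text \<open>Division by the uniform probability is multiplication by \<open>CARD('a)\<close>, so the
  cost is the relative entropy to the uniform distribution, divided by \<beta>.\<close>

lemma mean_cost_eq: "(\<Sum>a\<in>UNIV. pmf (\<pi> s) a * info_cost \<beta> \<pi> s a) = mean_cost \<beta> (\<pi> s)"
  by (cases "\<beta> = 0") (simp_all add: mean_cost_def info_cost_def uniform_policy_def sum_divide_distrib)

lemma sum_product_weight:
  fixes p q :: "'a::finite pmf"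
  shows "(\<Sum>a\<in>UNIV. \<Sum>b\<in>UNIV. pmf p a * pmf q b * c a) = (\<Sum>a\<in>UNIV. pmf p a * c a)"
    and "(\<Sum>a\<in>UNIV. \<Sum>b\<in>UNIV. pmf p a * pmf q b * d b) = (\<Sum>b\<in>UNIV. pmf q b * d b)"
proof -
  have "(\<Sum>a\<in>UNIV. \<Sum>b\<in>UNIV. pmf p a * pmf q b * c a) = (\<Sum>a\<in>UNIV. (\<Sum>b\<in>UNIV. pmf q b) * (pmf p a * c a))"
    unfolding sum_distrib_right by (simp add: mult_ac)
  then show "(\<Sum>a\<in>UNIV. \<Sum>b\<in>UNIV. pmf p a * pmf q b * c a) = (\<Sum>a\<in>UNIV. pmf p a * c a)"
    by simp
  have "(\<Sum>a\<in>UNIV. \<Sum>b\<in>UNIV. pmf p a * pmf q b * d b) = (\<Sum>a\<in>UNIV. pmf p a) * (\<Sum>b\<in>UNIV. pmf q b * d b)"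
    unfolding sum_product by (simp add: mult_ac)
  then show "(\<Sum>a\<in>UNIV. \<Sum>b\<in>UNIV. pmf p a * pmf q b * d b) = (\<Sum>b\<in>UNIV. pmf q b * d b)"
    by simp
qed

text \<open>The term at time 0 is the expected immediate soft reward; by
  \<open>law_Suc_first\<close> the remaining series is \<gamma> times the value averaged over the
  next state.\<close>

lemma soft_value_bellman:
  fixes R :: "'s::finite \<Rightarrow> 'a::finite \<Rightarrow> 'a \<Rightarrow> real"
  assumes \<gamma>: "0 \<le> \<gamma>" "\<gamma> < 1"
  shows "soft_value R T \<gamma> \<beta>pl \<beta>op \<pi> \<tau> s =
    payoff R T \<gamma> \<beta>pl \<beta>op (soft_value R T \<gamma> \<beta>pl \<beta>op \<pi> \<tau>) s (\<pi> s) (\<tau> s)"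
proof -
  let ?V = "soft_value R T \<gamma> \<beta>pl \<beta>op \<pi> \<tau>" and ?r = "soft_reward R \<beta>pl \<beta>op \<pi> \<tau>"
  let ?w = "\<lambda>a b. pmf (\<pi> s) a * pmf (\<tau> s) b"
  define e where "e s t = (\<integral>x. ?r x \<partial>law T \<pi> \<tau> s t)" for s t
  have V: "(\<lambda>t. \<gamma> ^ t * e s t) sums ?V s" for s
    using soft_value_eq_suminf[OF \<gamma>, where \<pi> = \<pi> and \<tau> = \<tau> and T = T and R = R and \<beta>pl = \<beta>pl and \<beta>op = \<beta>op]
    unfolding e_def by (simp add: sums_iff)
  have e0: "e s 0 = (\<Sum>a\<in>UNIV. \<Sum>b\<in>UNIV. ?w a b * R s a b) - mean_cost \<beta>pl (\<pi> s) - mean_cost \<beta>op (\<tau> s)"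
    by (simp add: e_def integral_act soft_reward_def right_diff_distrib sum_subtractf
        sum_product_weight mean_cost_eq)
  have eSuc: "e s (Suc t) = (\<Sum>a\<in>UNIV. \<Sum>b\<in>UNIV. ?w a b * (\<Sum>s'\<in>UNIV. pmf (T s a b) s' * e s' t))" for t
    unfolding e_def law_Suc_first
    by (simp add: integral_bind_pmf_finite integral_act integral_pmf_finite[where p = "T x y z" for x y z])
  have "(\<lambda>t. \<gamma> * (\<Sum>a\<in>UNIV. \<Sum>b\<in>UNIV. ?w a b * (\<Sum>s'\<in>UNIV. pmf (T s a b) s' * (\<gamma> ^ t * e s' t)))) sums
      (\<gamma> * (\<Sum>a\<in>UNIV. \<Sum>b\<in>UNIV. ?w a b * (\<Sum>s'\<in>UNIV. pmf (T s a b) s' * ?V s')))"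
    by (intro sums_mult sums_sum V)
  also have "(\<lambda>t. \<gamma> * (\<Sum>a\<in>UNIV. \<Sum>b\<in>UNIV. ?w a b * (\<Sum>s'\<in>UNIV. pmf (T s a b) s' * (\<gamma> ^ t * e s' t)))) =
      (\<lambda>t. \<gamma> ^ Suc t * e s (Suc t))"
    unfolding eSuc by (simp add: sum_distrib_left mult_ac)
  finally have "(\<lambda>t. \<gamma> ^ t * e s t) sums
      (\<gamma> * (\<Sum>a\<in>UNIV. \<Sum>b\<in>UNIV. ?w a b * (\<Sum>s'\<in>UNIV. pmf (T s a b) s' * ?V s')) + e s 0)"
    using sums_Suc[of "\<lambda>t. \<gamma> ^ t * e s t"] by simp
  with V[of s] have "?V s =
      \<gamma> * (\<Sum>a\<in>UNIV. \<Sum>b\<in>UNIV. ?w a b * (\<Sum>s'\<in>UNIV. pmf (T s a b) s' * ?V s')) + e s 0"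
    by (rule sums_unique2)
  then show ?thesis
    unfolding payoff_def gain_def e0
    by (simp add: distrib_left sum.distrib sum_distrib_left mult_ac)
qed

section \<open>Monotonicity, contraction and comparison of values\<close>

lemma pmf_average_le:
  fixes p :: "'b::finite pmf"
  assumes "\<And>x. f x \<le> D"
  shows "(\<Sum>x\<in>UNIV. pmf p x * f x) \<le> D"
proof -
  have "(\<Sum>x\<in>UNIV. pmf p x * f x) \<le> (\<Sum>x\<in>UNIV. pmf p x * D)"
    by (intro sum_mono mult_left_mono assms) simp
  then show ?thesis
    by (simp flip: sum_distrib_right)
qed

text \<open>Rewards and costs cancel, leaving \<gamma> times an average of \<open>v - w\<close>. The
  case \<open>D = 0\<close> gives monotonicity, the maximum of \<open>v - w\<close> gives the
  contraction estimate.\<close>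

lemma payoff_diff_le:
  fixes R :: "'s::finite \<Rightarrow> 'a::finite \<Rightarrow> 'a \<Rightarrow> real"
  assumes "0 \<le> \<gamma>" and le: "\<And>s. v s - w s \<le> D"
  shows "payoff R T \<gamma> \<beta>pl \<beta>op v s p q - payoff R T \<gamma> \<beta>pl \<beta>op w s p q \<le> \<gamma> * D"
proof -
  have "payoff R T \<gamma> \<beta>pl \<beta>op v s p q - payoff R T \<gamma> \<beta>pl \<beta>op w s p q =
      (\<Sum>a\<in>UNIV. pmf p a * (\<Sum>b\<in>UNIV. pmf q b * (\<gamma> * (\<Sum>s'\<in>UNIV. pmf (T s a b) s' * (v s' - w s')))))"
    by (simp add: payoff_def gain_def sum_distrib_left sum_subtractf sum.distrib algebra_simps)
  also have "\<dots> \<le> \<gamma> * D"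
    by (intro pmf_average_le mult_left_mono le \<open>0 \<le> \<gamma>\<close>)
  finally show ?thesis .
qed

lemma payoff_mono:
  fixes R :: "'s::finite \<Rightarrow> 'a::finite \<Rightarrow> 'a \<Rightarrow> real"
  assumes "0 \<le> \<gamma>" and "\<And>s. v s \<le> w s"
  shows "payoff R T \<gamma> \<beta>pl \<beta>op v s p q \<le> payoff R T \<gamma> \<beta>pl \<beta>op w s p q"
  using payoff_diff_le[of \<gamma> v w 0 R T \<beta>pl \<beta>op s p q] assms by simp

text \<open>This symmetry turns minimisation into maximisation. The parameters change sign with the
  rewards because the costs carry the factor 1/\<beta>.\<close>

lemma payoff_uminus:
  "payoff (\<lambda>s a b. - R s a b) T \<gamma> (- \<beta>pl) (- \<beta>op) (\<lambda>s. - v s) s p q =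
     - payoff R T \<gamma> \<beta>pl \<beta>op v s p q"
proof -
  have "gain (\<lambda>s a b. - R s a b) T \<gamma> (\<lambda>s. - v s) s a b = - gain R T \<gamma> v s a b" for a b
    by (simp add: gain_def sum_negf)
  moreover have "mean_cost (- \<beta>) r = - mean_cost \<beta> r" for \<beta> and r :: "'b::finite pmf"
    by (simp add: mean_cost_def)
  ultimately show ?thesis
    by (simp add: payoff_def sum_negf)
qed

text \<open>At a state where \<open>v - w\<close> takes its largest value \<open>D\<close>, the
  hypotheses and the contraction estimate give \<open>D \<le> \<gamma> * D\<close>, hence
  \<open>D \<le> 0\<close>.\<close>

lemma bellman_comparison:
  fixes R :: "'s::finite \<Rightarrow> 'a::finite \<Rightarrow> 'a \<Rightarrow> real"
  assumes \<gamma>: "0 \<le> \<gamma>" "\<gamma> < 1"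
    and v: "\<And>s. v s \<le> payoff R T \<gamma> \<beta>pl \<beta>op v s (\<pi> s) (\<tau> s)"
    and w: "\<And>s. payoff R T \<gamma> \<beta>pl \<beta>op w s (\<pi> s) (\<tau> s) \<le> w s"
  shows "v s \<le> w s"
proof -
  define D where "D = Max (range (\<lambda>s. v s - w s))"
  have D: "v s - w s \<le> D" for s
    unfolding D_def by (rule Max_ge) auto
  have "D \<in> range (\<lambda>s. v s - w s)"
    unfolding D_def by (rule Max_in) auto
  then obtain s0 where s0: "D = v s0 - w s0"
    by auto
  have "D \<le> \<gamma> * D"
    using v[of s0] w[of s0] payoff_diff_le[of \<gamma> v w D R T \<beta>pl \<beta>op s0 "\<pi> s0" "\<tau> s0", OF \<gamma>(1) D] s0 by linarith
  then have "(1 - \<gamma>) * D \<le> 0"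
    by (simp add: algebra_simps)
  then have "D \<le> 0"
    using \<gamma> by (simp add: mult_le_0_iff)
  then show ?thesis
    using D[of s] by linarith
qed

text \<open>The value equals its own image, so it can take the place of either function in
  \<open>bellman_comparison\<close>.\<close>

lemma
  fixes R :: "'s::finite \<Rightarrow> 'a::finite \<Rightarrow> 'a \<Rightarrow> real"
  assumes \<gamma>: "0 \<le> \<gamma>" "\<gamma> < 1"
  shows soft_value_ge: "(\<And>s. v s \<le> payoff R T \<gamma> \<beta>pl \<beta>op v s (\<pi> s) (\<tau> s)) \<Longrightarrow>
      v s \<le> soft_value R T \<gamma> \<beta>pl \<beta>op \<pi> \<tau> s"
    and soft_value_le: "(\<And>s. payoff R T \<gamma> \<beta>pl \<beta>op v s (\<pi> s) (\<tau> s) \<le> v s) \<Longrightarrow>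
      soft_value R T \<gamma> \<beta>pl \<beta>op \<pi> \<tau> s \<le> v s"
proof -
  note bell = soft_value_bellman[OF \<gamma>, of R T \<beta>pl \<beta>op \<pi> \<tau>]
  show "(\<And>s. v s \<le> payoff R T \<gamma> \<beta>pl \<beta>op v s (\<pi> s) (\<tau> s)) \<Longrightarrow>
      v s \<le> soft_value R T \<gamma> \<beta>pl \<beta>op \<pi> \<tau> s"
    by (rule bellman_comparison[OF \<gamma>, of v R T \<beta>pl \<beta>op \<pi> \<tau>]) (simp_all flip: bell)
  show "(\<And>s. payoff R T \<gamma> \<beta>pl \<beta>op v s (\<pi> s) (\<tau> s) \<le> v s) \<Longrightarrow>
      soft_value R T \<gamma> \<beta>pl \<beta>op \<pi> \<tau> s \<le> v s"
    by (rule bellman_comparison[OF \<gamma>, of _ R T \<beta>pl \<beta>op \<pi> \<tau>]) (simp_all flip: bell)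
qed

lemma soft_value_uminus:
  fixes R :: "'s::finite \<Rightarrow> 'a::finite \<Rightarrow> 'a \<Rightarrow> real"
  assumes \<gamma>: "0 \<le> \<gamma>" "\<gamma> < 1"
  shows "soft_value (\<lambda>s a b. - R s a b) T \<gamma> (- \<beta>pl) (- \<beta>op) \<pi> \<tau> s =
    - soft_value R T \<gamma> \<beta>pl \<beta>op \<pi> \<tau> s"
proof (rule antisym)
  note bell = soft_value_bellman[OF \<gamma>, of R T \<beta>pl \<beta>op \<pi> \<tau>]
  show "soft_value (\<lambda>s a b. - R s a b) T \<gamma> (- \<beta>pl) (- \<beta>op) \<pi> \<tau> s \<le>
      - soft_value R T \<gamma> \<beta>pl \<beta>op \<pi> \<tau> s"
    by (rule soft_value_le[OF \<gamma>]) (simp add: payoff_uminus flip: bell)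
  show "- soft_value R T \<gamma> \<beta>pl \<beta>op \<pi> \<tau> s \<le>
      soft_value (\<lambda>s a b. - R s a b) T \<gamma> (- \<beta>pl) (- \<beta>op) \<pi> \<tau> s"
    by (rule soft_value_ge[OF \<gamma>]) (simp add: payoff_uminus flip: bell)
qed

section \<open>Optimal policies\<close>

definition pmf_vec :: "'a::finite pmf \<Rightarrow> real ^ 'a" where
  "pmf_vec p = (\<chi> a. pmf p a)"

text \<open>The image is the probability simplex, a closed subset of the unit cube.\<close>

lemma compact_range_pmf_vec: "compact (range (pmf_vec :: 'a::finite pmf \<Rightarrow> real ^ 'a))"
proof -
  have "range pmf_vec = cbox 0 1 \<inter> {x :: real ^ 'a. (\<Sum>a\<in>UNIV. x $ a) = 1}" (is "_ = ?S")
  proof (intro antisym subsetI)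
    fix x :: "real ^ 'a" assume x: "x \<in> ?S"
    then have nonneg: "0 \<le> x $ a" for a
      by (simp add: mem_box_cart)
    have "(\<integral>\<^sup>+a. ennreal (x $ a) \<partial>count_space UNIV) = ennreal (\<Sum>a\<in>UNIV. x $ a)"
      by (simp add: nn_integral_count_space_finite nonneg sum_nonneg)
    then have "pmf_vec (embed_pmf (\<lambda>a. x $ a)) = x"
      using x by (simp add: pmf_vec_def vec_eq_iff pmf_embed_pmf nonneg)
    then show "x \<in> range pmf_vec"
      by (metis rangeI)
  qed (auto simp: pmf_vec_def mem_box_cart pmf_le_1)
  moreover have "closed {x :: real ^ 'a. (\<Sum>a\<in>UNIV. x $ a) = 1}"
    by (intro closed_Collect_eq continuous_intros)
  ultimately show ?thesis
    by (simp add: compact_Int_closed)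
qed

text \<open>Only 0 requires care: the limit from the right is 0 and agrees with the value there,
  which vanishes through the factor \<open>t\<close>.\<close>

lemma continuous_on_mult_ln:
  fixes c :: real
  assumes "0 < c"
  shows "continuous_on {0..} (\<lambda>t. t * ln (t * c))"
proof -
  have "((\<lambda>t. t * ln (t * c)) \<longlongrightarrow> 0) (at_right 0)"
    using assms by real_asymp
  moreover have "at (0::real) within {0..} = at_right 0"
    by (rule at_within_Ici_at_right)
  ultimately have "isCont (\<lambda>t. t * ln (t * c)) t \<or> ((\<lambda>t. t * ln (t * c)) \<longlongrightarrow> t * ln (t * c)) (at t within {0..})"
    if "0 \<le> t" for t
    using that assms by (cases "t = 0") (auto intro!: continuous_intros)
  then show ?thesis
    unfolding continuous_on_def isCont_def by (auto intro: tendsto_within_subset)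
qed

text \<open>The extreme value theorem for the payoff in coordinates. Continuity holds for parameters
  of either sign, so payoffs that are convex in a mixed action are covered too.\<close>

lemma payoff_attains_max:
  fixes R :: "'s::finite \<Rightarrow> 'a::finite \<Rightarrow> 'a \<Rightarrow> real"
  assumes A: "compact (pmf_vec ` A)" "A \<noteq> {}" and B: "compact (pmf_vec ` B)" "B \<noteq> {}"
  obtains p q where "p \<in> A" "q \<in> B"
    "\<And>p' q'. p' \<in> A \<Longrightarrow> q' \<in> B \<Longrightarrow>
      payoff R T \<gamma> \<beta>pl \<beta>op v s p' q' \<le> payoff R T \<gamma> \<beta>pl \<beta>op v s p q"
proof -
  define g where "g x = x * ln (x * CARD('a))" for x :: real
  define F where "F z = (\<Sum>a\<in>UNIV. \<Sum>b\<in>UNIV. fst z $ a * snd z $ b * gain R T \<gamma> v s a b)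
     - (\<Sum>a\<in>UNIV. g (fst z $ a)) / \<beta>pl
     - (\<Sum>a\<in>UNIV. g (snd z $ a)) / \<beta>op" for z :: "(real ^ 'a) \<times> (real ^ 'a)"
  let ?K = "pmf_vec ` A \<times> pmf_vec ` B"
  have F: "F (pmf_vec p, pmf_vec q) = payoff R T \<gamma> \<beta>pl \<beta>op v s p q" for p q
    by (simp add: F_def payoff_def mean_cost_def g_def pmf_vec_def)
  have g: "continuous_on {0..} g"
    unfolding g_def by (rule continuous_on_mult_ln) simp
  have "continuous_on ?K F"
    unfolding F_def
    \<comment> \<open>The parameters may be 0: multiplication by a constant inverse is continuous in
      any case, while the rule for quotients asks for a nonzero denominator.\<close>
    unfolding divide_inverse
    by (auto intro!: continuous_intros continuous_on_compose2[OF g] simp: pmf_vec_def)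
  then obtain z where z: "z \<in> ?K" "\<forall>z'\<in>?K. F z' \<le> F z"
    using continuous_attains_sup[of ?K F] A B by (metis compact_Times image_is_empty Times_empty)
  then obtain p q where pq: "z = (pmf_vec p, pmf_vec q)" "p \<in> A" "q \<in> B"
    by auto
  show ?thesis
  proof (rule that[OF pq(2,3)])
    fix p' q' assume "p' \<in> A" "q' \<in> B"
    then have "F (pmf_vec p', pmf_vec q') \<le> F (pmf_vec p, pmf_vec q)"
      using z(2) pq(1) by blast
    then show "payoff R T \<gamma> \<beta>pl \<beta>op v s p' q' \<le> payoff R T \<gamma> \<beta>pl \<beta>op v s p q"
      unfolding F .
  qed
qed

lemma payoff_bounded_above:
  fixes R :: "'s::finite \<Rightarrow> 'a::finite \<Rightarrow> 'a \<Rightarrow> real"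
  shows "\<exists>M. \<forall>s p q. payoff R T \<gamma> \<beta>pl \<beta>op v s p q \<le> M"
proof -
  let ?G = "payoff R T \<gamma> \<beta>pl \<beta>op v"
  have "\<exists>m. \<forall>p q. ?G s p q \<le> m" for s
    by (rule payoff_attains_max[of UNIV UNIV R T \<gamma> \<beta>pl \<beta>op v s])
      (auto simp: compact_range_pmf_vec)
  then obtain m where m: "\<And>s p q. ?G s p q \<le> m s"
    by metis
  have "?G s p q \<le> Max (range m)" for s p q
    using m[of s p q] by (rule order_trans) (auto intro: Max_ge)
  then show ?thesis
    by blast
qed

text \<open>Singleton sets \<open>A s\<close> or \<open>B s\<close> hold one policy fixed, so the
  same statement yields joint optima and best responses.\<close>

lemma optimal_policies:
  fixes R :: "'s::finite \<Rightarrow> 'a::finite \<Rightarrow> 'a \<Rightarrow> real"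
  assumes \<gamma>: "0 \<le> \<gamma>" "\<gamma> < 1"
    and A: "\<And>s. compact (pmf_vec ` A s)" "\<And>s. A s \<noteq> {}"
    and B: "\<And>s. compact (pmf_vec ` B s)" "\<And>s. B s \<noteq> {}"
  shows "\<exists>\<pi> \<tau>. (\<forall>s. \<pi> s \<in> A s) \<and> (\<forall>s. \<tau> s \<in> B s) \<and>
    (\<forall>\<pi>' \<tau>' s. (\<forall>s. \<pi>' s \<in> A s) \<longrightarrow> (\<forall>s. \<tau>' s \<in> B s) \<longrightarrow>
      soft_value R T \<gamma> \<beta>pl \<beta>op \<pi>' \<tau>' s \<le> soft_value R T \<gamma> \<beta>pl \<beta>op \<pi> \<tau> s)"
proof -
  let ?V = "soft_value R T \<gamma> \<beta>pl \<beta>op" and ?G = "payoff R T \<gamma> \<beta>pl \<beta>op"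
  have greedy: "\<exists>\<pi> \<tau>. \<forall>s. \<pi> s \<in> A s \<and> \<tau> s \<in> B s \<and> (\<forall>p\<in>A s. \<forall>q\<in>B s. ?G v s p q \<le> ?G v s (\<pi> s) (\<tau> s))"
    for v
  proof -
    have "\<forall>s. \<exists>x. fst x \<in> A s \<and> snd x \<in> B s \<and> (\<forall>p\<in>A s. \<forall>q\<in>B s. ?G v s p q \<le> ?G v s (fst x) (snd x))"
    proof
      fix s
      show "\<exists>x. fst x \<in> A s \<and> snd x \<in> B s \<and> (\<forall>p\<in>A s. \<forall>q\<in>B s. ?G v s p q \<le> ?G v s (fst x) (snd x))"
        by (rule payoff_attains_max[OF A[of s] B[of s], of R T \<gamma> \<beta>pl \<beta>op v s]) auto
    qed
    then obtain x where "\<forall>s. fst (x s) \<in> A s \<and> snd (x s) \<in> B s \<and>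
        (\<forall>p\<in>A s. \<forall>q\<in>B s. ?G v s p q \<le> ?G v s (fst (x s)) (snd (x s)))"
      by metis
    then show ?thesis
      by (intro exI[of _ "\<lambda>s. fst (x s)"] exI[of _ "\<lambda>s. snd (x s)"]) simp
  qed
  define X where "X = {z :: ('s \<Rightarrow> 'a pmf) \<times> ('s \<Rightarrow> 'a pmf). \<forall>s. fst z s \<in> A s \<and> snd z s \<in> B s}"
  define val where "val s = (\<lambda>z. ?V (fst z) (snd z) s) ` X" for s
  obtain M where M: "\<And>s p q. ?G (\<lambda>_. 0) s p q \<le> M"
    using payoff_bounded_above[of R T \<gamma> \<beta>pl \<beta>op "\<lambda>_. 0"] by blast
  \<comment> \<open>The constant is the fixed point of \<open>\<lambda>x. M + \<gamma> * x\<close>,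
    so as a function of the state it lies above its image under every Bellman operator.\<close>
  have bound: "?V \<pi> \<tau> s \<le> M / (1 - \<gamma>)" for \<pi> \<tau> s
  proof (rule soft_value_le[OF \<gamma>])
    fix s
    have "?G (\<lambda>_. M / (1 - \<gamma>)) s (\<pi> s) (\<tau> s) \<le> M + \<gamma> * (M / (1 - \<gamma>))"
      using payoff_diff_le[of \<gamma> "\<lambda>_. M / (1 - \<gamma>)" "\<lambda>_. 0" "M / (1 - \<gamma>)" R T \<beta>pl \<beta>op s "\<pi> s" "\<tau> s", OF \<gamma>(1)]
        M[of s "\<pi> s" "\<tau> s"] by simp
    also have "M + \<gamma> * (M / (1 - \<gamma>)) = M / (1 - \<gamma>)"
      using \<gamma> by (simp add: field_simps)
    finally show "?G (\<lambda>_. M / (1 - \<gamma>)) s (\<pi> s) (\<tau> s) \<le> M / (1 - \<gamma>)" .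
  qed
  \<comment> \<open>The supremum is taken in each state separately; a priori different pairs
    approach it in different states.\<close>
  define W where "W s = Sup (val s)" for s
  have bdd: "bdd_above (val s)" for s
    using bound by (force simp: val_def intro!: bdd_aboveI)
  have le_W: "?V \<pi> \<tau> s \<le> W s" if "(\<pi>, \<tau>) \<in> X" for \<pi> \<tau> s
    unfolding W_def by (rule cSup_upper[OF _ bdd]) (use that in \<open>force simp: val_def\<close>)
  obtain \<pi> \<tau> where \<pi>\<tau>: "\<And>s. \<pi> s \<in> A s" "\<And>s. \<tau> s \<in> B s"
      "\<And>s p q. p \<in> A s \<Longrightarrow> q \<in> B s \<Longrightarrow> ?G W s p q \<le> ?G W s (\<pi> s) (\<tau> s)"
    using greedy[of W] by blast
  \<comment> \<open>The value of an admissible pair lies below \<open>W\<close>, hence by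
    monotonicity below the payoff of that pair against \<open>W\<close>, which the greedy pair
    dominates.\<close>
  have "W s \<le> ?G W s (\<pi> s) (\<tau> s)" for s
    unfolding W_def[of s]
  proof (rule cSup_least)
    show "val s \<noteq> {}"
      using \<pi>\<tau>(1,2) by (auto simp: val_def X_def)
    fix x assume "x \<in> val s"
    then obtain \<pi>' \<tau>' where x: "x = ?V \<pi>' \<tau>' s" "(\<pi>', \<tau>') \<in> X"
      by (auto simp: val_def)
    have "x \<le> ?G W s (\<pi>' s) (\<tau>' s)"
      unfolding x(1)
      by (subst soft_value_bellman[OF \<gamma>]) (rule payoff_mono[OF \<gamma>(1) le_W[OF x(2)]])
    also have "\<dots> \<le> ?G W s (\<pi> s) (\<tau> s)"
      using x(2) by (intro \<pi>\<tau>(3)) (auto simp: X_def)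
    finally show "x \<le> ?G W s (\<pi> s) (\<tau> s)" .
  qed
  then have "W s \<le> ?V \<pi> \<tau> s" for s
    by (rule soft_value_ge[OF \<gamma>])
  then have "?V \<pi>' \<tau>' s \<le> ?V \<pi> \<tau> s" if "(\<pi>', \<tau>') \<in> X" for \<pi>' \<tau>' s
    using le_W[OF that] by (rule order_trans[rotated])
  then show ?thesis
    using \<pi>\<tau>(1,2) by (intro exI[of _ \<pi>] exI[of _ \<tau>]) (simp add: X_def)
qed

section \<open>Softmax responses and saddle points\<close>

definition softmax :: "('a::finite \<Rightarrow> real) \<Rightarrow> 'a pmf" where
  "softmax x = embed_pmf (\<lambda>a. exp (x a) / (\<Sum>b\<in>UNIV. exp (x b)))"

lemma sum_exp_pos: "0 < (\<Sum>b\<in>UNIV. exp (x (b :: 'a::finite) :: real))"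
  by (rule sum_pos) auto

lemma pmf_softmax: "pmf (softmax x) a = exp (x a) / (\<Sum>b\<in>UNIV. exp (x b))"
  unfolding softmax_def
proof (rule pmf_embed_pmf)
  show nonneg: "0 \<le> exp (x a) / (\<Sum>b\<in>UNIV. exp (x b))" for a
    using sum_exp_pos[of x] by simp
  have "(\<Sum>a\<in>UNIV. exp (x a) / (\<Sum>b\<in>UNIV. exp (x b))) = 1"
    using sum_exp_pos[of x] by (simp flip: sum_divide_distrib)
  then show "(\<integral>\<^sup>+a. ennreal (exp (x a) / (\<Sum>b\<in>UNIV. exp (x b))) \<partial>count_space UNIV) = 1"
    by (subst nn_integral_count_space_finite) (auto simp: nonneg)
qed

lemma pmf_softmax_pos: "0 < pmf (softmax x) a"
  using sum_exp_pos[of x] by (simp add: pmf_softmax)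

text \<open>With parameter 0 the softmax formula thus produces the reference policy.\<close>

lemma softmax_zero: "softmax (\<lambda>_. 0) = pmf_of_set UNIV"
  by (rule pmf_eqI) (simp add: pmf_softmax)

lemma continuous_on_softmax [continuous_intros]:
  fixes x :: "'z::topological_space \<Rightarrow> 'a::finite \<Rightarrow> real"
  assumes "\<And>a. continuous_on S (\<lambda>z. x z a)"
  shows "continuous_on S (\<lambda>z. pmf (softmax (x z)) a)"
  unfolding pmf_softmax
  by (intro continuous_intros assms ballI less_imp_neq[THEN not_sym] sum_exp_pos)

text \<open>The sum is minus the relative entropy of \<open>p\<close> with respect to
  \<open>q\<close>. By \<open>ln x \<le> x - 1\<close> each summand is at most
  \<open>pmf q a - pmf p a\<close>, and these differences sum to 0.\<close>

lemma gibbs_inequality: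
  fixes p q :: "'a::finite pmf"
  assumes "\<And>a. 0 < pmf q a"
  shows "(\<Sum>a\<in>UNIV. pmf p a * (ln (pmf q a) - ln (pmf p a))) \<le> 0"
proof -
  have "pmf p a * (ln (pmf q a) - ln (pmf p a)) \<le> pmf q a - pmf p a" for a
  proof (cases "pmf p a = 0")
    case False
    then have p: "0 < pmf p a"
      by (simp add: less_le)
    then have "ln (pmf q a) - ln (pmf p a) \<le> pmf q a / pmf p a - 1"
      using ln_le_minus_one[of "pmf q a / pmf p a"] assms[of a] by (simp add: ln_div)
    then have "pmf p a * (ln (pmf q a) - ln (pmf p a)) \<le> pmf p a * (pmf q a / pmf p a - 1)"
      using p by (intro mult_left_mono) auto
    also have "\<dots> = pmf q a - pmf p a"
      using p by (simp add: field_simps)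
    finally show ?thesis .
  qed simp
  then have "(\<Sum>a\<in>UNIV. pmf p a * (ln (pmf q a) - ln (pmf p a))) \<le> (\<Sum>a\<in>UNIV. pmf q a - pmf p a)"
    by (rule sum_mono)
  then show ?thesis
    by (simp add: sum_subtractf)
qed

text \<open>For nonzero \<beta>, each side is a constant minus the relative entropy with respect to
  \<open>q\<close>. The factor \<beta> lets one statement cover maximisers (\<beta> positive) and
  minimisers (\<beta> negative).\<close>

lemma softmax_optimal:
  fixes x :: "'a::finite \<Rightarrow> real" and \<beta> :: real
  defines "q \<equiv> softmax (\<lambda>a. \<beta> * x a)"
  shows "\<beta> * ((\<Sum>a\<in>UNIV. pmf p a * x a) - mean_cost \<beta> p) \<le>
    \<beta> * ((\<Sum>a\<in>UNIV. pmf q a * x a) - mean_cost \<beta> q)"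
proof (cases "\<beta> = 0")
  case False
  define Z where "Z = (\<Sum>b\<in>UNIV. exp (\<beta> * x b))"
  have Z: "0 < Z"
    unfolding Z_def by (rule sum_exp_pos)
  have q: "\<beta> * x a = ln (pmf q a) + ln Z" for a
    using Z by (simp add: q_def pmf_softmax ln_div flip: Z_def)
  have r: "\<beta> * ((\<Sum>a\<in>UNIV. pmf r a * x a) - mean_cost \<beta> r) =
      (\<Sum>a\<in>UNIV. pmf r a * (ln (pmf q a) - ln (pmf r a))) + (ln Z - ln CARD('a))" for r :: "'a pmf"
  proof -
    have ln: "pmf r a * ln (pmf r a * CARD('a)) = pmf r a * (ln (pmf r a) + ln CARD('a))" for a
      by (cases "pmf r a = 0") (auto simp: ln_mult less_le)
    have "\<beta> * ((\<Sum>a\<in>UNIV. pmf r a * x a) - mean_cost \<beta> r) =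
        (\<Sum>a\<in>UNIV. pmf r a * (\<beta> * x a)) - (\<Sum>a\<in>UNIV. pmf r a * ln (pmf r a * CARD('a)))"
      using False by (simp add: mean_cost_def right_diff_distrib)
        (simp add: sum_distrib_left mult.left_commute)
    also have "\<dots> = (\<Sum>a\<in>UNIV. pmf r a * (ln (pmf q a) - ln (pmf r a)) + pmf r a * (ln Z - ln CARD('a)))"
      unfolding ln q sum_subtractf[symmetric] by (intro sum.cong) (auto simp: algebra_simps)
    also have "\<dots> = (\<Sum>a\<in>UNIV. pmf r a * (ln (pmf q a) - ln (pmf r a))) + (ln Z - ln CARD('a))"
      by (simp add: sum.distrib flip: sum_distrib_right)
    finally show ?thesis .
  qed
  have "(\<Sum>a\<in>UNIV. pmf p a * (ln (pmf q a) - ln (pmf p a))) \<le> 0"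
    by (rule gibbs_inequality) (simp add: q_def pmf_softmax_pos)
  then show ?thesis
    unfolding r by simp
qed simp

text \<open>The value function is part of the Brouwer fixed point, so mutual softmax responses and
  the Bellman equation come out together. Signs of the parameters enter only later, when these
  responses are recognised as optimal.\<close>

lemma softmax_equilibrium:
  fixes R :: "'s::finite \<Rightarrow> 'a::finite \<Rightarrow> 'a \<Rightarrow> real"
  assumes \<gamma>: "0 \<le> \<gamma>" "\<gamma> < 1"
  shows "\<exists>\<pi> \<tau> v. \<forall>s.
    v s = payoff R T \<gamma> \<beta>pl \<beta>op v s (\<pi> s) (\<tau> s) \<and>
    \<pi> s = softmax (\<lambda>a. \<beta>pl * (\<Sum>b\<in>UNIV. pmf (\<tau> s) b * gain R T \<gamma> v s a b)) \<and>
    \<tau> s = softmax (\<lambda>b. \<beta>op * (\<Sum>a\<in>UNIV. pmf (\<pi> s) a * gain R T \<gamma> v s a b))"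
proof -
  let ?G = "payoff R T \<gamma> \<beta>pl \<beta>op"
  obtain M1 where M1: "\<And>s p q. ?G (\<lambda>_. 0) s p q \<le> M1"
    using payoff_bounded_above[of R T \<gamma> \<beta>pl \<beta>op "\<lambda>_. 0"] by blast
  \<comment> \<open>An upper bound in the negated game is a lower bound in the original one.\<close>
  obtain M2 where M2: "\<And>s p q. payoff (\<lambda>s a b. - R s a b) T \<gamma> (- \<beta>pl) (- \<beta>op) (\<lambda>_. 0) s p q \<le> M2"
    using payoff_bounded_above[of "\<lambda>s a b. - R s a b" T \<gamma> "- \<beta>pl" "- \<beta>op" "\<lambda>_. 0"] by blast
  \<comment> \<open>These choices give \<open>M + \<gamma> * B = B\<close>, so value functions
    bounded by \<open>B\<close> have payoffs bounded by \<open>B\<close>; the 0 in the maximum keeps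
    the box nonempty.\<close>
  define M where "M = max (max M1 M2) 0"
  define B where "B = M / (1 - \<gamma>)"
  have "0 \<le> B"
    using \<gamma> by (simp add: B_def M_def)
  have B: "M + \<gamma> * B = B"
    using \<gamma> by (simp add: B_def field_simps)
  have bound: "\<bar>?G v s p q\<bar> \<le> B" if v: "\<And>s. \<bar>v s\<bar> \<le> B" for v s p q
  proof -
    have G0: "\<bar>?G (\<lambda>_. 0) s p q\<bar> \<le> M"
      using M1[of s p q] M2[of s p q] payoff_uminus[of R T \<gamma> \<beta>pl \<beta>op "\<lambda>_. 0" s p q]
      by (simp add: M_def)
    have "v s \<le> B" "- v s \<le> B" for s
      using v[of s] by linarith+
    then have "?G v s p q - ?G (\<lambda>_. 0) s p q \<le> \<gamma> * B" "?G (\<lambda>_. 0) s p q - ?G v s p q \<le> \<gamma> * B"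
      by (auto intro!: payoff_diff_le \<gamma>)
    with G0 B show ?thesis
      by linarith
  qed
  \<comment> \<open>Cubes replace products of simplices: \<open>P\<close> and \<open>Q\<close>
    accept arbitrary coordinates as weights, and their softmax outputs are distributions
    anyway.\<close>
  define X where "X = (cbox 0 1 :: (real ^ ('s \<times> 'a)) set) \<times> (cbox 0 1 :: (real ^ ('s \<times> 'a)) set) \<times>
    cbox (\<chi> s::'s. - B) (\<chi> s. B)"
  define P where "P z s = softmax (\<lambda>a. \<beta>pl *
      (\<Sum>b\<in>UNIV. fst (snd z) $ (s, b) * gain R T \<gamma> (($) (snd (snd z))) s a b))"
    for z :: "(real ^ ('s \<times> 'a)) \<times> (real ^ ('s \<times> 'a)) \<times> (real ^ 's)" and s
  define Q where "Q z s = softmax (\<lambda>b. \<beta>op *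
      (\<Sum>a\<in>UNIV. fst z $ (s, a) * gain R T \<gamma> (($) (snd (snd z))) s a b))"
    for z :: "(real ^ ('s \<times> 'a)) \<times> (real ^ ('s \<times> 'a)) \<times> (real ^ 's)" and s
  \<comment> \<open>The third component uses the updated policies, which are always distributions;
    at a fixed point they agree with the first two components.\<close>
  define f where "f z = ((\<chi> i. pmf (P z (fst i)) (snd i)), (\<chi> i. pmf (Q z (fst i)) (snd i)),
      (\<chi> s. ?G (($) (snd (snd z))) s (P z s) (Q z s)))"
    for z :: "(real ^ ('s \<times> 'a)) \<times> (real ^ ('s \<times> 'a)) \<times> (real ^ 's)"
  have X: "compact X" "convex X" "X \<noteq> {}"
    using \<open>0 \<le> B\<close> unfolding X_def
    by (auto intro!: compact_Times convex_Times simp: interval_ne_empty_cart)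
  have P: "continuous_on X (\<lambda>z. pmf (P z s) a)" for s a
    unfolding P_def gain_def by (intro continuous_intros)
  have Q: "continuous_on X (\<lambda>z. pmf (Q z s) a)" for s a
    unfolding Q_def gain_def by (intro continuous_intros)
  \<comment> \<open>Positivity keeps the logarithms in the costs away from 0.\<close>
  have pos: "0 < pmf (P z s) a" "0 < pmf (Q z s) a" for z s a
    unfolding P_def Q_def by (rule pmf_softmax_pos)+
  have "continuous_on X (\<lambda>z. ?G (($) (snd (snd z))) s (P z s) (Q z s))" for s
    unfolding payoff_def mean_cost_def gain_def divide_inverse
    by (intro continuous_intros P Q) (use pos in \<open>auto simp: less_le\<close>)
  then have "continuous_on X f"
    unfolding f_def by (intro continuous_intros continuous_on_vec_lambda P Q)
  moreover have "f \<in> X \<rightarrow> X"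
  proof
    fix z assume "z \<in> X"
    then have "- B \<le> snd (snd z) $ s \<and> snd (snd z) $ s \<le> B" for s
      unfolding X_def mem_Times_iff mem_box_cart by simp
    then have "\<bar>snd (snd z) $ s\<bar> \<le> B" for s
      unfolding abs_le_iff by (metis minus_le_iff)
    then have "\<bar>?G (($) (snd (snd z))) s (P z s) (Q z s)\<bar> \<le> B" for s
      by (rule bound)
    then have "- B \<le> ?G (($) (snd (snd z))) s (P z s) (Q z s) \<and> ?G (($) (snd (snd z))) s (P z s) (Q z s) \<le> B" for s
      unfolding abs_le_iff by (metis minus_le_iff)
    then show "f z \<in> X"
      unfolding X_def mem_Times_iff mem_box_cart by (simp add: f_def pmf_le_1)
  qed
  ultimately obtain z where z: "f z = z"
    using brouwer[OF X] by metis
  define v where "v = ($) (snd (snd z))"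
  have zP: "fst z $ (s, a) = pmf (P z s) a" for s a
    by (subst z[symmetric]) (simp add: f_def)
  have zQ: "fst (snd z) $ (s, a) = pmf (Q z s) a" for s a
    by (subst z[symmetric]) (simp add: f_def)
  have zv: "v s = ?G v s (P z s) (Q z s)" for s
    unfolding v_def by (subst (1) z[symmetric]) (simp add: f_def)
  have "P z s = softmax (\<lambda>a. \<beta>pl * (\<Sum>b\<in>UNIV. pmf (Q z s) b * gain R T \<gamma> v s a b))" for s
    by (subst P_def) (simp add: zQ v_def)
  moreover have "Q z s = softmax (\<lambda>b. \<beta>op * (\<Sum>a\<in>UNIV. pmf (P z s) a * gain R T \<gamma> v s a b))" for s
    by (subst Q_def) (simp add: zP v_def)
  ultimately show ?thesis
    using zv by (intro exI[of _ "P z"] exI[of _ "Q z"] exI[of _ v] allI conjI)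
qed

section \<open>Best responses and attained extrema\<close>

definition choices :: "real \<Rightarrow> 'a::finite pmf set" where
  "choices \<beta> = (if \<beta> = 0 then {pmf_of_set UNIV} else UNIV)"

text \<open>Admissibility is a condition on each state separately, the form that
  \<open>optimal_policies\<close> works with.\<close>

lemma policies_iff: "\<pi> \<in> policies \<beta> \<longleftrightarrow> (\<forall>s. \<pi> s \<in> choices \<beta>)"
  by (auto simp: policies_def choices_def uniform_policy_def)

lemma choices_nonempty: "choices \<beta> \<noteq> {}"
  by (simp add: choices_def)

lemma compact_choices: "compact (pmf_vec ` choices \<beta>)"
  by (simp add: choices_def compact_range_pmf_vec)

lemma payoff_softmax_pl:
  assumes "0 \<le> \<beta>pl" "p' \<in> choices \<beta>pl"
    and p: "p = softmax (\<lambda>a. \<beta>pl * (\<Sum>b\<in>UNIV. pmf q b * gain R T \<gamma> v s a b))"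
  shows "payoff R T \<gamma> \<beta>pl \<beta>op v s p' q \<le> payoff R T \<gamma> \<beta>pl \<beta>op v s p q"
proof (cases "\<beta>pl = 0")
  case True
  then show ?thesis
    using assms by (simp add: choices_def softmax_zero)
next
  case False
  have "payoff R T \<gamma> \<beta>pl \<beta>op v s r q =
      ((\<Sum>a\<in>UNIV. pmf r a * (\<Sum>b\<in>UNIV. pmf q b * gain R T \<gamma> v s a b)) - mean_cost \<beta>pl r) - mean_cost \<beta>op q" for r
    by (simp add: payoff_def sum_distrib_left mult.assoc)
  then show ?thesis
    using softmax_optimal[of \<beta>pl p' "\<lambda>a. \<Sum>b\<in>UNIV. pmf q b * gain R T \<gamma> v s a b"] False \<open>0 \<le> \<beta>pl\<close>
    by (simp add: p)
qed

text \<open>The common factor \<beta>op is negative, so cancelling it reverses the inequality of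
  \<open>softmax_optimal\<close>.\<close>

lemma payoff_softmax_op:
  assumes "\<beta>op < 0"
    and q: "q = softmax (\<lambda>b. \<beta>op * (\<Sum>a\<in>UNIV. pmf p a * gain R T \<gamma> v s a b))"
  shows "payoff R T \<gamma> \<beta>pl \<beta>op v s p q \<le> payoff R T \<gamma> \<beta>pl \<beta>op v s p q'"
proof -
  have "payoff R T \<gamma> \<beta>pl \<beta>op v s p r =
      ((\<Sum>b\<in>UNIV. pmf r b * (\<Sum>a\<in>UNIV. pmf p a * gain R T \<gamma> v s a b)) - mean_cost \<beta>op r) - mean_cost \<beta>pl p" for r
    unfolding payoff_def by (subst sum.swap) (simp add: sum_distrib_left mult_ac)
  then show ?thesis
    using softmax_optimal[of \<beta>op q' "\<lambda>b. \<Sum>a\<in>UNIV. pmf p a * gain R T \<gamma> v s a b"] \<open>\<beta>op < 0\<close>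
    by (simp add: q)
qed

text \<open>The equilibrium \<open>v\<close> is the value of the softmax pair. When one agent
  deviates, one-shot optimality puts \<open>v\<close> above or below its new image, which bounds the
  value of the deviation in every state.\<close>

lemma soft_value_saddle_point:
  fixes R :: "'s::finite \<Rightarrow> 'a::finite \<Rightarrow> 'a \<Rightarrow> real"
  assumes \<gamma>: "0 \<le> \<gamma>" "\<gamma> < 1" and \<beta>: "0 \<le> \<beta>pl" "\<beta>op < 0"
  obtains \<pi> \<tau> where "\<pi> \<in> policies \<beta>pl"
    "\<And>\<pi>' s. \<pi>' \<in> policies \<beta>pl \<Longrightarrow>
      soft_value R T \<gamma> \<beta>pl \<beta>op \<pi>' \<tau> s \<le> soft_value R T \<gamma> \<beta>pl \<beta>op \<pi> \<tau> s"
    "\<And>\<tau>' s. soft_value R T \<gamma> \<beta>pl \<beta>op \<pi> \<tau> s \<le> soft_value R T \<gamma> \<beta>pl \<beta>op \<pi> \<tau>' s"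
proof -
  let ?V = "soft_value R T \<gamma> \<beta>pl \<beta>op" and ?G = "payoff R T \<gamma> \<beta>pl \<beta>op"
  obtain \<pi> \<tau> v where *: "\<forall>s. v s = ?G v s (\<pi> s) (\<tau> s) \<and>
      \<pi> s = softmax (\<lambda>a. \<beta>pl * (\<Sum>b\<in>UNIV. pmf (\<tau> s) b * gain R T \<gamma> v s a b)) \<and>
      \<tau> s = softmax (\<lambda>b. \<beta>op * (\<Sum>a\<in>UNIV. pmf (\<pi> s) a * gain R T \<gamma> v s a b))"
    using softmax_equilibrium[OF \<gamma>, of R T \<beta>pl \<beta>op] by (elim exE) (rule that)
  note eq = *[THEN spec, THEN conjunct1] *[THEN spec, THEN conjunct2, THEN conjunct1]
    *[THEN spec, THEN conjunct2, THEN conjunct2]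
  have V: "?V \<pi> \<tau> s = v s" for s
    by (intro antisym soft_value_le[OF \<gamma>] soft_value_ge[OF \<gamma>]) (simp_all flip: eq(1))
  show ?thesis
  proof (rule that)
    show "\<pi> \<in> policies \<beta>pl"
      unfolding policies_iff
    proof
      fix s
      show "\<pi> s \<in> choices \<beta>pl"
        by (cases "\<beta>pl = 0") (simp_all add: choices_def eq(2)[of s] softmax_zero)
    qed
    fix s
    show "?V \<pi>' \<tau> s \<le> ?V \<pi> \<tau> s" if "\<pi>' \<in> policies \<beta>pl" for \<pi>'
      unfolding V
    proof (rule soft_value_le[OF \<gamma>])
      fix s
      have "?G v s (\<pi>' s) (\<tau> s) \<le> ?G v s (\<pi> s) (\<tau> s)"
        using that by (intro payoff_softmax_pl[OF \<beta>(1) _ eq(2)]) (simp add: policies_iff)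
      also have "\<dots> = v s"
        by (rule eq(1)[symmetric])
      finally show "?G v s (\<pi>' s) (\<tau> s) \<le> v s" .
    qed
    show "?V \<pi> \<tau> s \<le> ?V \<pi> \<tau>' s" for \<tau>'
      unfolding V
    proof (rule soft_value_ge[OF \<gamma>])
      fix s
      have "v s = ?G v s (\<pi> s) (\<tau> s)"
        by (rule eq(1))
      also have "\<dots> \<le> ?G v s (\<pi> s) (\<tau>' s)"
        by (rule payoff_softmax_op[OF \<beta>(2) eq(3)])
      finally show "v s \<le> ?G v s (\<pi> s) (\<tau>' s)" .
    qed
  qed
qed

text \<open>The policy of the other agent is confined to a singleton. The parameters \<beta>1,
  \<beta>2 of the value are separate from those of the policy sets, because passing to the negated
  game for the minimum changes only the former.\<close>

lemma
  fixes R :: "'s::finite \<Rightarrow> 'a::finite \<Rightarrow> 'a \<Rightarrow> real"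
  assumes \<gamma>: "0 \<le> \<gamma>" "\<gamma> < 1"
  shows has_maximum_soft_value_pl:
      "has_maximum (policies \<beta>pl) (\<lambda>\<pi>. soft_value R T \<gamma> \<beta>1 \<beta>2 \<pi> \<tau> s)" (is ?pl)
    and has_maximum_soft_value_op:
      "has_maximum (policies \<beta>op) (\<lambda>\<tau>. soft_value R T \<gamma> \<beta>1 \<beta>2 \<pi> \<tau> s)" (is ?op)
    and has_minimum_soft_value_op:
      "has_minimum (policies \<beta>op) (\<lambda>\<tau>. soft_value R T \<gamma> \<beta>1 \<beta>2 \<pi> \<tau> s)" (is ?min)
proof -
  have "\<exists>\<sigma> \<tau>'. (\<forall>s. \<sigma> s \<in> choices \<beta>pl) \<and> (\<forall>s. \<tau>' s \<in> {\<tau> s}) \<and>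
      (\<forall>\<pi> \<rho> s. (\<forall>s. \<pi> s \<in> choices \<beta>pl) \<longrightarrow> (\<forall>s. \<rho> s \<in> {\<tau> s}) \<longrightarrow>
        soft_value R T \<gamma> \<beta>1 \<beta>2 \<pi> \<rho> s \<le> soft_value R T \<gamma> \<beta>1 \<beta>2 \<sigma> \<tau>' s)"
    by (rule optimal_policies[OF \<gamma>]) (simp_all add: compact_choices choices_nonempty)
  then obtain \<sigma> \<tau>' where opt: "\<forall>s. \<sigma> s \<in> choices \<beta>pl" "\<forall>s. \<tau>' s \<in> {\<tau> s}"
      "\<forall>\<pi> \<rho> s. (\<forall>s. \<pi> s \<in> choices \<beta>pl) \<longrightarrow> (\<forall>s. \<rho> s \<in> {\<tau> s}) \<longrightarrow>
        soft_value R T \<gamma> \<beta>1 \<beta>2 \<pi> \<rho> s \<le> soft_value R T \<gamma> \<beta>1 \<beta>2 \<sigma> \<tau>' s"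
    by (elim exE conjE) (rule that)
  have "\<tau>' = \<tau>"
    using opt(2) by auto
  then show ?pl
    unfolding has_maximum_def
    using opt(3) by (intro bexI[of _ \<sigma>] ballI)
      (simp_all add: opt(1) policies_iff)
  have op: "has_maximum (policies \<beta>op) (\<lambda>\<tau>. soft_value R T \<gamma> \<beta>1 \<beta>2 \<pi> \<tau> s)" for R \<beta>1 \<beta>2
  proof -
    have "\<exists>\<pi>' \<sigma>. (\<forall>s. \<pi>' s \<in> {\<pi> s}) \<and> (\<forall>s. \<sigma> s \<in> choices \<beta>op) \<and>
        (\<forall>\<rho> \<tau> s. (\<forall>s. \<rho> s \<in> {\<pi> s}) \<longrightarrow> (\<forall>s. \<tau> s \<in> choices \<beta>op) \<longrightarrow>
          soft_value R T \<gamma> \<beta>1 \<beta>2 \<rho> \<tau> s \<le> soft_value R T \<gamma> \<beta>1 \<beta>2 \<pi>' \<sigma> s)"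
      by (rule optimal_policies[OF \<gamma>]) (simp_all add: compact_choices choices_nonempty)
    then obtain \<pi>' \<sigma> where opt: "\<forall>s. \<pi>' s \<in> {\<pi> s}" "\<forall>s. \<sigma> s \<in> choices \<beta>op"
        "\<forall>\<rho> \<tau> s. (\<forall>s. \<rho> s \<in> {\<pi> s}) \<longrightarrow> (\<forall>s. \<tau> s \<in> choices \<beta>op) \<longrightarrow>
          soft_value R T \<gamma> \<beta>1 \<beta>2 \<rho> \<tau> s \<le> soft_value R T \<gamma> \<beta>1 \<beta>2 \<pi>' \<sigma> s"
      by (elim exE conjE) (rule that)
    have "\<pi>' = \<pi>"
      using opt(1) by auto
    then show ?thesis
      unfolding has_maximum_def
      using opt(3) by (intro bexI[of _ \<sigma>] ballI)
        (simp_all add: opt(2) policies_iff)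
  qed
  then show ?op .
  show ?min
    using op[of "\<lambda>s a b. - R s a b" "- \<beta>1" "- \<beta>2"]
    by (simp add: soft_value_uminus[OF \<gamma>] has_maximum_def has_minimum_def)
qed

section \<open>Iterated maxima and minima\<close>

lemma maximum_eqI: "x \<in> X \<Longrightarrow> (\<And>y. y \<in> X \<Longrightarrow> f y \<le> f x) \<Longrightarrow> maximum X f = f x"
  unfolding maximum_def by (rule Greatest_equality) auto

lemma minimum_eqI: "x \<in> X \<Longrightarrow> (\<And>y. y \<in> X \<Longrightarrow> f x \<le> f y) \<Longrightarrow> minimum X f = f x"
  unfolding minimum_def by (rule Least_equality) auto

lemma maximum_upper: "has_maximum X f \<Longrightarrow> x \<in> X \<Longrightarrow> f x \<le> maximum X f"
  unfolding has_maximum_def using maximum_eqI[of _ X f] by metis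

lemma minimum_lower: "has_minimum X f \<Longrightarrow> x \<in> X \<Longrightarrow> minimum X f \<le> f x"
  unfolding has_minimum_def using minimum_eqI[of _ X f] by metis

lemma maximum_attained: "has_maximum X f \<Longrightarrow> \<exists>x\<in>X. maximum X f = f x"
  unfolding has_maximum_def using maximum_eqI[of _ X f] by metis

text \<open>A joint maximiser solves the iterated problem. Exchanging the roles of \<open>X\<close>
  and \<open>Y\<close> leaves the number \<open>f x0 y0\<close> unchanged, so the two iterated
  maxima agree.\<close>

lemma maximum_maximum_eqI:
  assumes "\<And>x. x \<in> X \<Longrightarrow> has_maximum Y (f x)" "x0 \<in> X" "y0 \<in> Y"
    and le: "\<And>x y. x \<in> X \<Longrightarrow> y \<in> Y \<Longrightarrow> f x y \<le> f x0 y0"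
  shows "has_maximum X (\<lambda>x. maximum Y (f x))" "maximum X (\<lambda>x. maximum Y (f x)) = f x0 y0"
proof -
  have eq: "maximum Y (f x0) = f x0 y0"
    using assms by (intro maximum_eqI) auto
  have "maximum Y (f x) \<le> f x0 y0" if "x \<in> X" for x
    using maximum_attained[OF assms(1)[OF that]] le[OF that] by auto
  then show "has_maximum X (\<lambda>x. maximum Y (f x))" "maximum X (\<lambda>x. maximum Y (f x)) = f x0 y0"
    using maximum_eqI[of x0 X "\<lambda>x. maximum Y (f x)"] \<open>x0 \<in> X\<close> by (auto simp: has_maximum_def eq intro!: bexI[of _ x0])
qed

text \<open>Both iterated extrema equal \<open>f x0 y0\<close>. Attainment is assumed at all points
  so that the inner \<open>minimum\<close> and \<open>maximum\<close> are actual bounds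
  there.\<close>

lemma saddle_point_value:
  assumes min: "\<And>x. x \<in> X \<Longrightarrow> has_minimum Y (f x)"
    and max: "\<And>y. y \<in> Y \<Longrightarrow> has_maximum X (\<lambda>x. f x y)"
    and X: "x0 \<in> X" and Y: "y0 \<in> Y"
    and le: "\<And>x. x \<in> X \<Longrightarrow> f x y0 \<le> f x0 y0" and ge: "\<And>y. y \<in> Y \<Longrightarrow> f x0 y0 \<le> f x0 y"
  shows "has_maximum X (\<lambda>x. minimum Y (f x))" "has_minimum Y (\<lambda>y. maximum X (\<lambda>x. f x y))"
    "maximum X (\<lambda>x. minimum Y (f x)) = minimum Y (\<lambda>y. maximum X (\<lambda>x. f x y))"
proof -
  have eq: "minimum Y (f x0) = f x0 y0" "maximum X (\<lambda>x. f x y0) = f x0 y0"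
    using X Y le ge minimum_eqI[of y0 Y "f x0"] maximum_eqI[of x0 X "\<lambda>x. f x y0"] by auto
  have m: "minimum Y (f x) \<le> f x0 y0" if "x \<in> X" for x
    using minimum_lower[OF min[OF that] Y] le[OF that] by linarith
  have M: "f x0 y0 \<le> maximum X (\<lambda>x. f x y)" if "y \<in> Y" for y
    using maximum_upper[OF max[OF that] X] ge[OF that] by linarith
  show "has_maximum X (\<lambda>x. minimum Y (f x))" "has_minimum Y (\<lambda>y. maximum X (\<lambda>x. f x y))"
    using X Y m M by (auto simp: has_maximum_def has_minimum_def eq intro!: bexI[of _ x0] bexI[of _ y0])
  show "maximum X (\<lambda>x. minimum Y (f x)) = minimum Y (\<lambda>y. maximum X (\<lambda>x. f x y))"
    using maximum_eqI[of x0 X "\<lambda>x. minimum Y (f x)"] minimum_eqI[of y0 Y "\<lambda>y. maximum X (\<lambda>x. f x y)"]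
      X Y m M by (simp add: eq)
qed

theorem corollary2:
  fixes R :: "'s::finite \<Rightarrow> 'a::finite \<Rightarrow> 'a \<Rightarrow> real"
    and T :: "'s \<Rightarrow> 'a \<Rightarrow> 'a \<Rightarrow> 's pmf"
    and \<gamma> \<beta>pl \<beta>op :: real
  assumes "0 \<le> \<gamma>" and "\<gamma> < 1"
    and "0 \<le> \<beta>pl \<or> 0 \<le> \<beta>op"
  shows "\<forall>s. extrema_attained R T \<gamma> \<beta>pl \<beta>op s \<and>
    value_pl R T \<gamma> \<beta>pl \<beta>op s = value_op R T \<gamma> \<beta>pl \<beta>op s"
proof
  fix s
  note \<gamma> = assms(1,2)
  let ?V = "\<lambda>\<pi> \<tau>. soft_value R T \<gamma> \<beta>pl \<beta>op \<pi> \<tau> s"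
  note attained = has_maximum_soft_value_pl[OF \<gamma>] has_maximum_soft_value_op[OF \<gamma>]
    has_minimum_soft_value_op[OF \<gamma>]
  show "extrema_attained R T \<gamma> \<beta>pl \<beta>op s \<and>
    value_pl R T \<gamma> \<beta>pl \<beta>op s = value_op R T \<gamma> \<beta>pl \<beta>op s"
  proof (cases "\<beta>op < 0")
    case True
    \<comment> \<open>Against a minimising opponent this sign makes the softmax response of the
      player a best response.\<close>
    then have "0 \<le> \<beta>pl"
      using assms(3) by simp
    then obtain \<pi> \<tau> where "\<pi> \<in> policies \<beta>pl" "\<And>\<pi>'. \<pi>' \<in> policies \<beta>pl \<Longrightarrow> ?V \<pi>' \<tau> \<le> ?V \<pi> \<tau>"
        "\<And>\<tau>'. ?V \<pi> \<tau> \<le> ?V \<pi> \<tau>'"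
      using soft_value_saddle_point[OF \<gamma> _ True, of \<beta>pl R T] by metis
    moreover have "\<tau> \<in> policies \<beta>op"
      using True by (simp add: policies_def)
    ultimately show ?thesis
      using saddle_point_value[of "policies \<beta>pl" "policies \<beta>op" ?V \<pi> \<tau>] True
      by (simp add: attained extrema_attained_def value_pl_def value_op_def ext_def has_ext_def)
  next
    case False
    \<comment> \<open>Both agents maximise here, so a joint optimum settles both orders, whatever
      the sign of \<beta>pl.\<close>
    have "\<exists>\<pi> \<tau>. (\<forall>s. \<pi> s \<in> choices \<beta>pl) \<and> (\<forall>s. \<tau> s \<in> choices \<beta>op) \<and>
        (\<forall>\<pi>' \<tau>' s. (\<forall>s. \<pi>' s \<in> choices \<beta>pl) \<longrightarrow> (\<forall>s. \<tau>' s \<in> choices \<beta>op) \<longrightarrow>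
          soft_value R T \<gamma> \<beta>pl \<beta>op \<pi>' \<tau>' s \<le> soft_value R T \<gamma> \<beta>pl \<beta>op \<pi> \<tau> s)"
      by (rule optimal_policies[OF \<gamma>]) (simp_all add: compact_choices choices_nonempty)
    then obtain \<pi> \<tau> where opt: "\<pi> \<in> policies \<beta>pl" "\<tau> \<in> policies \<beta>op"
        "\<And>\<pi>' \<tau>'. \<pi>' \<in> policies \<beta>pl \<Longrightarrow> \<tau>' \<in> policies \<beta>op \<Longrightarrow> ?V \<pi>' \<tau>' \<le> ?V \<pi> \<tau>"
      unfolding policies_iff by blast
    show ?thesis
      using maximum_maximum_eqI[of "policies \<beta>pl" "policies \<beta>op" ?V \<pi> \<tau>]
        maximum_maximum_eqI[of "policies \<beta>op" "policies \<beta>pl" "\<lambda>\<tau> \<pi>. ?V \<pi> \<tau>" \<tau> \<pi>] opt False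
      by (simp add: attained extrema_attained_def value_pl_def value_op_def ext_def has_ext_def)
  qed
qed

end
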